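(* Let $1\le \ell_1\le k_1$ and $\ell_2\ge 1$ be integers, let $p\in[0,1]$, $q=1-p$, and put $a(p)=q^{\ell_1}p^{\ell_2}$, $\ell=\ell_1+\ell_2$, $m_1=k_1-\ell_1+1$. Let $H^n_{\ell_1,k_1,\ell_2}$ be the number of occurrences, in $n$ independent Bernoulli($p$) trials, of at least $\ell_1$ and at most $k_1$ consecutive 0's followed by at least $\ell_2$ consecutive 1's, and let $\phi_n(t)$, $p_{m,n}$, $\mu_{n,j}$ be its probability generating function, probability mass function and $j$-th non-central moment. Then, for all $n\ge \ell$: (i) $\phi_n(t)=\phi_{n-1}(t)+a(p)(t-1)\left[\phi_{n-\ell}(t)-q^{m_1}\phi_{n-\ell-m_1}(t)\right]$, with initial conditions $\phi_n(t)=1$ for $0\le n\le \ell-1$ (and $\phi_n(t)=0$ for $n<0$). (ii) For every integer $m\ge 0$, $p_{m,n}=p_{m,n-1}+a(p)\left[p_{m-1,n-\ell}-p_{m,n-\ell}-q^{m_1}(p_{m-1,n-\ell-m_1}-p_{m,n-\ell-m_1})\right]$, with initial conditions $p_{0,n}=1$ and $p_{m,n}=0$ for $m>0$, when $0\le n\le \ell-1$ (and $p_{m,n}=0$ if $n<0$ or $m<0$). (iii) For every integer $j\ge 1$, $\mu_{n,j}=\mu_{n-1,j}+a(p)\sum_{k=0}^{j-1}\binom{j}{k}\left[\mu_{n-\ell,k}-q^{m_1}\mu_{n-\ell-m_1,k}\right]$, with initial conditions $\mu_{n,0}=1$ for $n\ge0$, $\mu_{n,j}=0$ for all $j\ge 1$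 and $0\le n\le \ell-1$ (and $\mu_{n,j}=0$ for all $j\ge 0$ if $n<0$).
   Context: Let $\zeta_1,\zeta_2,\dots$ be independent with $P(\zeta_i=1)=p$ and $P(\zeta_i=0)=q=1-p$. $H^n_{\ell_1,k_1,\ell_2}$ is the number of occurrences of the following pattern within $\zeta_1,\dots,\zeta_n$: a maximal block of consecutive 0's (i.e. one starting at position 1 or immediately preceded by a 1, and ended by a 1) of length $j$ with $\ell_1\le j\le k_1$, immediately followed by at least $\ell_2$ consecutive 1's, where these first $\ell_2$ ones all lie in positions $\le n$. (The pattern is counted as soon as the $\ell_2$-th of these 1's occurs, and once per maximal block of 0's.) For example, for the sequence 00111101100010100011 of length 20, $H^{20}_{1,1,1}=2$, $H^{20}_{1,2,2}=2$, $H^{20}_{2,2,3}=1$, $H^{20}_{1,2,1}=3$. For $n\ge0$: $\phi_n(t)=E\big[t^{H^n_{\ell_1,k_1,\ell_2}}\big]$, $p_{m,n}=P(H^n_{\ell_1,k_1,\ell_2}=m)$, $\mu_{n,j}=E\big[(H^n_{\ell_1,k_1,\ell_2})^j\big]$ (with $0^0=1$, so $\mu_{n,0}=1$). Quantities with a negative time index $n$ are set equal to $0$. *)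

theory Defs
  imports "HOL-Probability.Probability"
begin

text \<open>Trial outcomes are sequences \<open>x 1, x 2, \<dots>\<close>; the value \<open>x 0\<close> is never inspected.\<close>

definition maximal_zero_block :: "(nat \<Rightarrow> real) \<Rightarrow> nat \<Rightarrow> nat \<Rightarrow> bool" where
  "maximal_zero_block x s j \<longleftrightarrow>
     1 \<le> s \<and> 1 \<le> j \<and> (\<forall>i\<in>{s..<s + j}. x i = 0) \<and> (s = 1 \<or> x (s - 1) = 1) \<and> x (s + j) = 1"

text \<open>An occurrence is recorded by the start \<open>s\<close> and the length \<open>j\<close> of its block of zeros, so it is
  counted once per block; the last inequality says that the \<open>l2\<close>-th one after the block lies
  at a position at most \<open>n\<close>.\<close>

definition pattern_count :: "nat \<Rightarrow> nat \<Rightarrow> nat \<Rightarrow> nat \<Rightarrow> (nat \<Rightarrow> real) \<Rightarrow> nat" where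
  "pattern_count l1 k1 l2 n x =
     card {(s, j). maximal_zero_block x s j \<and> l1 \<le> j \<and> j \<le> k1 \<and>
                   (\<forall>i\<in>{s + j..<s + j + l2}. x i = 1) \<and> s + j + l2 - 1 \<le> n}"

definition bernoulli_trials :: "'a measure \<Rightarrow> real \<Rightarrow> (nat \<Rightarrow> 'a \<Rightarrow> real) \<Rightarrow> bool" where
  "bernoulli_trials M p \<zeta> \<longleftrightarrow>
     prob_space M \<and> prob_space.indep_vars M (\<lambda>_. borel) \<zeta> {1..} \<and>
     (\<forall>i\<ge>1. measure M {\<omega> \<in> space M. \<zeta> i \<omega> = 1} = p \<and>
             measure M {\<omega> \<in> space M. \<zeta> i \<omega> = 0} = 1 - p)"

definition pattern_rv ::
  "nat \<Rightarrow> nat \<Rightarrow> nat \<Rightarrow> (nat \<Rightarrow> 'a \<Rightarrow> real) \<Rightarrow> nat \<Rightarrow> 'a \<Rightarrow> nat" where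
  "pattern_rv l1 k1 l2 \<zeta> n \<omega> = pattern_count l1 k1 l2 n (\<lambda>i. \<zeta> i \<omega>)"

text \<open>The generating function, mass function and moments of a sequence \<open>H\<close> of counting variables.
  Times and the argument of the mass function are integers so that the convention of vanishing at
  negative indices can be expressed.\<close>

definition gen_fun :: "'a measure \<Rightarrow> (nat \<Rightarrow> 'a \<Rightarrow> nat) \<Rightarrow> int \<Rightarrow> real \<Rightarrow> real" where
  "gen_fun M H n t = (if n < 0 then 0 else \<integral>\<omega>. t ^ H (nat n) \<omega> \<partial>M)"

definition mass_fun :: "'a measure \<Rightarrow> (nat \<Rightarrow> 'a \<Rightarrow> nat) \<Rightarrow> int \<Rightarrow> int \<Rightarrow> real" where
  "mass_fun M H m n =
     (if n < 0 then 0 else measure M {\<omega> \<in> space M. int (H (nat n) \<omega>) = m})"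

definition nc_moment :: "'a measure \<Rightarrow> (nat \<Rightarrow> 'a \<Rightarrow> nat) \<Rightarrow> int \<Rightarrow> nat \<Rightarrow> real" where
  "nc_moment M H n j = (if n < 0 then 0 else \<integral>\<omega>. real (H (nat n) \<omega>) ^ j \<partial>M)"

end

theory Submission
  imports Defs
begin

text \<open>
  A new occurrence at time \<open>n\<close> means that the trials up to \<open>n\<close> end with \<open>l1\<close> zeros and \<open>l2\<close> ones, but
  not with \<open>k1 + 1\<close> zeros and \<open>l2\<close> ones. If the trials after time \<open>k\<close> are a nonempty run of zeros
  followed by \<open>l2\<close> ones, no occurrence is completed between time \<open>k\<close> and the last of these ones, so
  the count just before it is the count at time \<open>k\<close>, which is independent of that run. Hence
  \<open>E f(H n) = E f(H (n - 1)) + a (E g(H (n - l)) - q ^ m1 E g(H (n - l - m1)))\<close> for every \<open>f\<close>,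
  where \<open>g h = f (h + 1) - f h\<close>; powers of \<open>t\<close>, indicators of points and monomials in place of \<open>f\<close>
  give the three recursions.
\<close>

section \<open>Occurrences and counts in a fixed sequence\<close>

definition zeros_ones :: "(nat \<Rightarrow> real) \<Rightarrow> nat \<Rightarrow> nat \<Rightarrow> nat \<Rightarrow> bool" where
  "zeros_ones x s j r \<longleftrightarrow> (\<forall>i\<in>{s..<s + j}. x i = 0) \<and> (\<forall>i\<in>{s + j..<s + j + r}. x i = 1)"

text \<open>The time bound is split off, so that in \<open>pattern_count_eq\<close> only the last
  inequality depends on \<open>n\<close>. In contrast to \<open>zeros_ones\<close>, the block of
  zeros has to be maximal.\<close>

definition occurs_at :: "nat \<Rightarrow> nat \<Rightarrow> nat \<Rightarrow> (nat \<Rightarrow> real) \<Rightarrow> nat \<times> nat \<Rightarrow> bool" where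
  "occurs_at l1 k1 l2 x = (\<lambda>(s, j). maximal_zero_block x s j \<and> l1 \<le> j \<and> j \<le> k1 \<and>
                                    (\<forall>i\<in>{s + j..<s + j + l2}. x i = 1))"

lemma pattern_count_eq:
  "pattern_count l1 k1 l2 n x = card {(s, j). occurs_at l1 k1 l2 x (s, j) \<and> s + j + l2 - 1 \<le> n}"
  unfolding pattern_count_def occurs_at_def by (rule arg_cong[where f = card]) auto

text \<open>Of two blocks with the same end, the one that starts earlier would contain the 1 that
  precedes the other. Hence at most one occurrence is completed at each time.\<close>

lemma occurs_at_unique:
  assumes "occurs_at l1 k1 l2 x (s, j)" "occurs_at l1 k1 l2 x (s', j')" "s + j = s' + j'"
  shows "s = s'"
proof -
  have "\<not> s < s'" if "occurs_at l1 k1 l2 x (s, j)" "occurs_at l1 k1 l2 x (s', j')" "s + j = s' + j'"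
    for s j s' j'
  proof
    assume "s < s'"
    with that have "x (s' - 1) = 1" "s' - 1 \<in> {s..<s + j}" "\<forall>i\<in>{s..<s + j}. x i = 0"
      by (auto simp: occurs_at_def maximal_zero_block_def)
    then show False by auto
  qed
  from this[of s j s' j'] this[of s' j' s j] assms show ?thesis by auto
qed

lemma finite_occurrences:
  "finite {(s, j). occurs_at l1 k1 l2 x (s, j) \<and> s + j + l2 - 1 \<le> n}"
  by (rule finite_subset[of _ "{..n + 1} \<times> {..n + 1}"]) auto

text \<open>The \<open>l2\<close>-th one of \<open>(s, j)\<close> stands at position
  \<open>s + j + l2 - 1\<close>, so completion at time \<open>n + 1\<close> reads
  \<open>s + j + l2 = n + 2\<close>. By \<open>occurs_at_unique\<close> at most one pair joins the
  set.\<close>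

lemma pattern_count_Suc:
  assumes "1 \<le> l2"
  shows "pattern_count l1 k1 l2 (Suc n) x =
    pattern_count l1 k1 l2 n x + of_bool (\<exists>s j. occurs_at l1 k1 l2 x (s, j) \<and> s + j + l2 = n + 2)"
    (is "_ = _ + of_bool ?new")
proof -
  let ?S = "\<lambda>n. {(s, j). occurs_at l1 k1 l2 x (s, j) \<and> s + j + l2 - 1 \<le> n}"
  show ?thesis
  proof (cases ?new)
    case True
    then obtain s j where sj: "occurs_at l1 k1 l2 x (s, j)" "s + j + l2 = n + 2"
      by blast
    have "?S (Suc n) = insert (s, j) (?S n)"
    proof (intro equalityI subsetI)
      fix z assume "z \<in> ?S (Suc n)"
      then obtain s' j' where z: "z = (s', j')" "occurs_at l1 k1 l2 x (s', j')" "s' + j' + l2 - 1 \<le> Suc n"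
        by auto
      show "z \<in> insert (s, j) (?S n)"
      proof (cases "s' + j' + l2 - 1 \<le> n")
        case False
        then have "s' + j' = s + j" using z sj by linarith
        with occurs_at_unique[OF z(2) sj(1)] show ?thesis using z by simp
      qed (use z in auto)
    qed (use sj in auto)
    moreover have "(s, j) \<notin> ?S n" using sj by auto
    ultimately show ?thesis
      using True finite_occurrences[of l1 k1 l2 x n] by (simp add: pattern_count_eq)
  next
    case False
    have "s + j + l2 - 1 \<le> Suc n \<longleftrightarrow> s + j + l2 - 1 \<le> n" if "occurs_at l1 k1 l2 x (s, j)" for s j
    proof -
      from False that have "s + j + l2 \<noteq> n + 2" by blast
      with assms show ?thesis by arith
    qed
    then have "?S (Suc n) = ?S n" by blast
    with False show ?thesis by (simp add: pattern_count_eq)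
  qed
qed

text \<open>An occurrence completed after time \<open>k\<close> but before the last of these ones
  would need \<open>l2\<close> consecutive ones, and this window would reach back into the zeros at
  \<open>k + 1\<close>, ..., \<open>k + j\<close>.\<close>

lemma pattern_count_zeros_ones:
  assumes "zeros_ones x (Suc k) j l2" "1 \<le> j" "1 \<le> l2"
  shows "pattern_count l1 k1 l2 (k + j + l2 - 1) x = pattern_count l1 k1 l2 k x"
proof -
  have "s + i + l2 - 1 \<le> k"
    if "occurs_at l1 k1 l2 x (s, i)" "s + i + l2 - 1 \<le> k + j + l2 - 1" for s i
  proof (rule ccontr)
    assume *: "\<not> s + i + l2 - 1 \<le> k"
    have ones: "\<forall>i\<in>{s + i..<s + i + l2}. x i = 1"
      using that by (auto simp: occurs_at_def)
    have zeros: "\<forall>i\<in>{Suc k..<Suc k + j}. x i = 0"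
      using assms by (auto simp: zeros_ones_def)
    \<comment> \<open>A position common to the window of ones and the run of zeros: the end of
      whichever stops first.\<close>
    define e where "e = min (s + i + l2 - 1) (k + j)"
    have "e \<in> {s + i..<s + i + l2}" "e \<in> {Suc k..<Suc k + j}"
      using * that assms by (auto simp: e_def)
    with ones zeros show False by force
  qed
  then have "occurs_at l1 k1 l2 x (s, i) \<and> s + i + l2 - 1 \<le> k + j + l2 - 1 \<longleftrightarrow>
      occurs_at l1 k1 l2 x (s, i) \<and> s + i + l2 - 1 \<le> k" for s i
    using assms by fastforce
  then show ?thesis
    unfolding pattern_count_eq by presburger
qed

text \<open>The zeros end at \<open>k + l1\<close>, so the block has length at least
  \<open>l1\<close> iff the last \<open>l1\<close> of these positions carry zeros, and more than
  \<open>k1\<close> iff the last \<open>k1 + 1\<close> do. The inequality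
  \<open>k1 + 1 - l1 \<le> k\<close> says that \<open>k1 + 1\<close> zeros fit after position 0; it
  also keeps the natural subtraction honest.\<close>

lemma occurs_at_iff_zeros_ones:
  assumes "\<And>i. 1 \<le> i \<Longrightarrow> x i = 0 \<or> x i = 1" "1 \<le> l1" "l1 \<le> k1" "1 \<le> l2"
  shows "(\<exists>s j. occurs_at l1 k1 l2 x (s, j) \<and> s + j + l2 = k + l1 + l2 + 1) \<longleftrightarrow>
    zeros_ones x (Suc k) l1 l2 \<and> \<not> (k1 + 1 - l1 \<le> k \<and> zeros_ones x (Suc (k - (k1 + 1 - l1))) (k1 + 1) l2)"
    (is "?L \<longleftrightarrow> ?A \<and> \<not> ?B")
proof
  assume ?L
  then obtain s j where sj: "occurs_at l1 k1 l2 x (s, j)" and sum: "s + j = Suc k + l1" by auto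
  then have ones: "\<forall>i\<in>{s + j..<s + j + l2}. x i = 1" and zeros: "\<forall>i\<in>{s..<s + j}. x i = 0"
    and "l1 \<le> j" "j \<le> k1" "s = 1 \<or> x (s - 1) = 1" "1 \<le> s"
    by (auto simp: occurs_at_def maximal_zero_block_def)
  have ?A using ones zeros sum \<open>l1 \<le> j\<close> by (auto simp: zeros_ones_def)
  moreover have "\<not> ?B"
  proof
    assume B: ?B
    \<comment> \<open>For \<open>s = 1\<close> the block fills all positions up to
      \<open>k + l1\<close>, so \<open>k + l1 \<le> k1\<close> and \<open>k1 + 1\<close> zeros do
      not fit.\<close>
    then have "s \<noteq> 1" using sum \<open>j \<le> k1\<close> by linarith
    then have "x (s - 1) = 1" using \<open>s = 1 \<or> x (s - 1) = 1\<close> by blast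
    moreover have "s - 1 \<in> {Suc (k - (k1 + 1 - l1))..<Suc (k - (k1 + 1 - l1)) + (k1 + 1)}"
      using B sum \<open>j \<le> k1\<close> \<open>l1 \<le> j\<close> \<open>s \<noteq> 1\<close> \<open>1 \<le> s\<close> assms by auto
    ultimately show False using B unfolding zeros_ones_def by fastforce
  qed
  ultimately show "?A \<and> \<not> ?B" by blast
next
  assume AB: "?A \<and> \<not> ?B"
  \<comment> \<open>The maximal block is found by extending the zeros to the left as far as
    possible: its start is the least \<open>s\<close> with \<open>Q s\<close>. Since the values are
    binary, it is preceded by a 1 or starts at 1.\<close>
  define Q where "Q s \<longleftrightarrow> 1 \<le> s \<and> (\<forall>i\<in>{s..<Suc k + l1}. x i = 0)" for s
  have "Q (Suc k)" using AB by (auto simp: Q_def zeros_ones_def)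
  then obtain s where "Q s" and least: "\<And>r. r < s \<Longrightarrow> \<not> Q r"
    using exists_least_iff[of Q] by blast
  have s: "1 \<le> s" "\<forall>i\<in>{s..<Suc k + l1}. x i = 0" "s \<le> Suc k"
    using \<open>Q s\<close> least \<open>Q (Suc k)\<close> by (auto simp: Q_def simp flip: not_less)
  have maximal: "s = 1 \<or> x (s - 1) = 1"
  proof (rule ccontr)
    assume "\<not> ?thesis"
    then have "1 \<le> s - 1" "x (s - 1) = 0" using assms(1)[of "s - 1"] s by auto
    moreover have "{s - 1..<Suc k + l1} = insert (s - 1) {s..<Suc k + l1}" using s by auto
    ultimately have "Q (s - 1)" using s by (simp add: Q_def)
    with least[of "s - 1"] s show False by simp
  qed
  define j where "j = Suc k + l1 - s"
  have sum: "s + j = Suc k + l1" using s by (simp add: j_def)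
  have ones: "\<forall>i\<in>{s + j..<s + j + l2}. x i = 1"
    unfolding sum using AB by (auto simp: zeros_ones_def)
  have "j \<le> k1"
  proof (rule ccontr)
    assume "\<not> j \<le> k1"
    then have "k1 + 1 - l1 \<le> k" "Suc (k - (k1 + 1 - l1)) \<ge> s"
      and start: "Suc (k - (k1 + 1 - l1)) + (k1 + 1) = Suc k + l1"
      using sum s assms by auto
    then have ?B
      using s ones unfolding zeros_ones_def start sum by auto
    with AB show False by blast
  qed
  then have "occurs_at l1 k1 l2 x (s, j)"
    using s maximal ones sum assms
    by (auto simp: occurs_at_def maximal_zero_block_def)
  with sum show ?L by auto
qed

lemma pattern_count_eq_0:
  assumes "1 \<le> l2" "n < l1 + l2"
  shows "pattern_count l1 k1 l2 n x = 0"
proof -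
  have "{(s, j). occurs_at l1 k1 l2 x (s, j) \<and> s + j + l2 - 1 \<le> n} = {}"
    using assms by (auto simp: occurs_at_def maximal_zero_block_def)
  then show ?thesis by (simp only: pattern_count_eq card.empty)
qed

text \<open>All inspected positions lie in \<open>{1..n}\<close>, including \<open>s + j\<close>,
  which is the first of the \<open>l2\<close> ones. So the count factors through the trials
  \<open>1\<close>, ..., \<open>n\<close>, which gives its measurability and its independence of
  later trials.\<close>

lemma pattern_count_cong:
  assumes "\<And>i. 1 \<le> i \<Longrightarrow> i \<le> n \<Longrightarrow> x i = y i" "1 \<le> l2"
  shows "pattern_count l1 k1 l2 n x = pattern_count l1 k1 l2 n y"
proof -
  have "occurs_at l1 k1 l2 x (s, j) \<longleftrightarrow> occurs_at l1 k1 l2 y (s, j)" if "s + j + l2 - 1 \<le> n" for s j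
  proof (cases "1 \<le> s")
    case True
    then have "x i = y i" if "i \<in> {s..<s + j} \<union> {s + j..<s + j + l2}" for i
      using that \<open>s + j + l2 - 1 \<le> n\<close> by (intro assms(1)) auto
    then have "(\<forall>i\<in>{s..<s + j}. x i = 0) \<longleftrightarrow> (\<forall>i\<in>{s..<s + j}. y i = 0)"
      "(\<forall>i\<in>{s + j..<s + j + l2}. x i = 1) \<longleftrightarrow> (\<forall>i\<in>{s + j..<s + j + l2}. y i = 1)"
      by simp_all
    moreover have "s = 1 \<or> x (s - 1) = 1 \<longleftrightarrow> s = 1 \<or> y (s - 1) = 1"
    proof (cases "s = 1")
      case False
      then have "x (s - 1) = y (s - 1)"
        using True \<open>s + j + l2 - 1 \<le> n\<close> assms(2) by (intro assms(1)) auto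
      then show ?thesis by simp
    qed simp
    moreover have "x (s + j) = y (s + j)"
      using True \<open>s + j + l2 - 1 \<le> n\<close> assms(2) by (intro assms(1)) auto
    ultimately show ?thesis
      unfolding occurs_at_def maximal_zero_block_def prod.case by presburger
  qed (auto simp: occurs_at_def maximal_zero_block_def)
  then have "{(s, j). occurs_at l1 k1 l2 x (s, j) \<and> s + j + l2 - 1 \<le> n} =
             {(s, j). occurs_at l1 k1 l2 y (s, j) \<and> s + j + l2 - 1 \<le> n}"
    by auto
  then show ?thesis by (simp only: pattern_count_eq)
qed

text \<open>A crude bound suffices: it makes every function of the count bounded, hence
  integrable.\<close>

lemma pattern_count_le: "pattern_count l1 k1 l2 n x \<le> (n + 2) * (n + 2)"
proof -
  have "card {(s, j). occurs_at l1 k1 l2 x (s, j) \<and> s + j + l2 - 1 \<le> n} \<le> card ({..n + 1} \<times> {..n + 1})"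
    by (intro card_mono) auto
  then show ?thesis by (simp add: pattern_count_eq card_cartesian_product)
qed

section \<open>Measurability of the count on the product space of the first trials\<close>

lemma pred_occurs_at:
  assumes "1 \<le> l2" "s + j + l2 - 1 \<le> n"
  shows "Measurable.pred (PiM {1..n} (\<lambda>_. borel)) (\<lambda>x. occurs_at l1 k1 l2 x (s, j))"
proof (cases "1 \<le> s")
  case True
  have eq: "Measurable.pred (PiM {1..n} (\<lambda>_. borel)) (\<lambda>x. x i = (c :: real))"
    if "1 \<le> i" "i \<le> n" for i c
  proof -
    have "(\<lambda>x. x i) \<in> borel_measurable (PiM {1..n} (\<lambda>_. borel :: real measure))"
      using that by (intro measurable_component_singleton) auto
    then show ?thesis by measurable
  qed
  have before: "Measurable.pred (PiM {1..n} (\<lambda>_. borel)) (\<lambda>x. s = 1 \<or> x (s - 1) = (1 :: real))"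
  \<comment> \<open>For \<open>s = 1\<close> the position \<open>s - 1 = 0\<close> is not a
    coordinate of the product space, so this case is separated.\<close>
  proof (cases "s = 1")
    case False
    then have "Measurable.pred (PiM {1..n} (\<lambda>_. borel)) (\<lambda>x. x (s - 1) = (1 :: real))"
      using True assms by (intro eq) auto
    with False show ?thesis by simp
  qed simp
  have zeros: "Measurable.pred (PiM {1..n} (\<lambda>_. borel)) (\<lambda>x. \<forall>i\<in>{s..<s + j}. x i = (0 :: real))"
    using True assms by (intro pred_intros_finite eq) auto
  have ones: "Measurable.pred (PiM {1..n} (\<lambda>_. borel))
      (\<lambda>x. \<forall>i\<in>{s + j..<s + j + l2}. x i = (1 :: real))"
    using True assms by (intro pred_intros_finite eq) auto
  have after: "Measurable.pred (PiM {1..n} (\<lambda>_. borel)) (\<lambda>x. x (s + j) = (1 :: real))"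
    using True assms by (intro eq) auto
  show ?thesis
    unfolding occurs_at_def maximal_zero_block_def prod.case
    by (intro pred_intros_logic(3) before zeros ones after) simp_all
qed (simp add: occurs_at_def maximal_zero_block_def)

lemma measurable_pattern_count:
  assumes "1 \<le> l2"
  shows "pattern_count l1 k1 l2 n \<in> PiM {1..n} (\<lambda>_. borel) \<rightarrow>\<^sub>M count_space UNIV"
proof -
  \<comment> \<open>\<open>measurable_card\<close> is about sets of natural numbers only, so the pairs are encoded.\<close>
  define T where "T x = {(s, j). occurs_at l1 k1 l2 x (s, j) \<and> s + j + l2 - 1 \<le> n}" for x
  have "pattern_count l1 k1 l2 n = (\<lambda>x. card (prod_decode -` T x))"
    unfolding pattern_count_eq T_def[symmetric]
    by (intro ext card_vimage_inj[symmetric] inj_prod_decode) (simp add: surj_prod_decode)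
  moreover have "{x \<in> space (PiM {1..n} (\<lambda>_. borel)). i \<in> prod_decode -` T x} \<in> sets (PiM {1..n} (\<lambda>_. borel))"
    for i
  proof -
    obtain s j where sj: "prod_decode i = (s, j)" by (cases "prod_decode i")
    show ?thesis
    proof (cases "s + j + l2 - 1 \<le> n")
      case True
      with pred_occurs_at[OF assms True] show ?thesis by (simp add: T_def sj pred_def)
    qed (simp add: T_def sj)
  qed
  ultimately show ?thesis by (simp add: measurable_card)
qed

section \<open>Expectations for Bernoulli trials\<close>

lemma (in prob_space) expectation_of_bool:
  "expectation (\<lambda>\<omega>. of_bool (Q \<omega>)) = prob {\<omega> \<in> space M. Q \<omega>}"
proof -
  have "expectation (\<lambda>\<omega>. of_bool (Q \<omega>)) = expectation (indicator {\<omega> \<in> space M. Q \<omega>})"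
    by (intro Bochner_Integration.integral_cong) (auto simp: indicator_def)
  also have "\<dots> = prob ({\<omega> \<in> space M. Q \<omega>} \<inter> space M)"
    by simp
  also have "{\<omega> \<in> space M. Q \<omega>} \<inter> space M = {\<omega> \<in> space M. Q \<omega>}"
    by auto
  finally show ?thesis .
qed

locale bernoulli_process = prob_space M for M :: "'a measure" +
  fixes p :: real and \<zeta> :: "nat \<Rightarrow> 'a \<Rightarrow> real"
  assumes indep: "indep_vars (\<lambda>_. borel) \<zeta> {1..}"
    and prob_one: "1 \<le> i \<Longrightarrow> prob {\<omega> \<in> space M. \<zeta> i \<omega> = 1} = p"
    and prob_zero: "1 \<le> i \<Longrightarrow> prob {\<omega> \<in> space M. \<zeta> i \<omega> = 0} = 1 - p"

lemma bernoulli_trials_iff: "bernoulli_trials M p \<zeta> \<longleftrightarrow> bernoulli_process M p \<zeta>"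
  by (auto simp: bernoulli_trials_def bernoulli_process_def bernoulli_process_axioms_def)

context bernoulli_process
begin

lemma borel_measurable_trial: "1 \<le> i \<Longrightarrow> \<zeta> i \<in> borel_measurable M"
  using indep by (simp add: indep_vars_def)

text \<open>The trials are real-valued, but the probabilities of 0 and 1 add up to 1, so other
  values have probability 0 for each of countably many trials. This supplies the binary hypothesis
  of \<open>occurs_at_iff_zeros_ones\<close>.\<close>

lemma AE_binary: "AE \<omega> in M. \<forall>i. 1 \<le> i \<longrightarrow> \<zeta> i \<omega> = 0 \<or> \<zeta> i \<omega> = 1"
proof (subst AE_all_countable, intro allI)
  fix i
  show "AE \<omega> in M. 1 \<le> i \<longrightarrow> \<zeta> i \<omega> = 0 \<or> \<zeta> i \<omega> = 1"
  proof (cases "1 \<le> i")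
    case True
    note [measurable] = borel_measurable_trial[OF True]
    let ?Z = "\<lambda>c. {\<omega> \<in> space M. \<zeta> i \<omega> = c}"
    have "prob (?Z 0 \<union> ?Z 1) = prob (?Z 0) + prob (?Z 1)"
      by (rule finite_measure_Union) auto
    then have "prob (?Z 0 \<union> ?Z 1) = 1"
      using True by (simp add: prob_one prob_zero)
    from AE_prob_1[OF this] show ?thesis by eventually_elim auto
  qed simp
qed

lemma prob_zeros_ones:
  assumes "1 \<le> r"
  shows "prob {\<omega> \<in> space M. zeros_ones (\<lambda>i. \<zeta> i \<omega>) (Suc k) j r} = (1 - p) ^ j * p ^ r"
proof -
  let ?Z = "{Suc k..<Suc k + j}" and ?O = "{Suc k + j..<Suc k + j + r}"
  \<comment> \<open>The prescribed value at position \<open>i\<close>: 0 in the first block and 1 in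
    the second, so that independence is applied once to the whole run.\<close>
  define c :: "nat \<Rightarrow> real" where "c i = of_bool (Suc k + j \<le> i)" for i
  have vimage: "\<zeta> i -` {c'} \<inter> space M = {\<omega> \<in> space M. \<zeta> i \<omega> = c'}" for i c'
    by auto
  have "{\<omega> \<in> space M. zeros_ones (\<lambda>i. \<zeta> i \<omega>) (Suc k) j r} = (\<Inter>i\<in>?Z \<union> ?O. \<zeta> i -` {c i} \<inter> space M)"
    using assms by (fastforce simp: zeros_ones_def c_def)
  also have "prob \<dots> = (\<Prod>i\<in>?Z \<union> ?O. prob (\<zeta> i -` {c i} \<inter> space M))"
    using assms by (intro indep_varsD[OF indep]) auto
  also have "\<dots> = (\<Prod>i\<in>?Z. prob (\<zeta> i -` {c i} \<inter> space M)) * (\<Prod>i\<in>?O. prob (\<zeta> i -` {c i} \<inter> space M))"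
    by (rule prod.union_disjoint) auto
  also have "(\<Prod>i\<in>?Z. prob (\<zeta> i -` {c i} \<inter> space M)) = (\<Prod>i\<in>?Z. 1 - p)"
    by (intro prod.cong) (simp_all add: c_def vimage prob_zero)
  also have "(\<Prod>i\<in>?O. prob (\<zeta> i -` {c i} \<inter> space M)) = (\<Prod>i\<in>?O. p)"
    by (intro prod.cong) (simp_all add: c_def vimage prob_one)
  finally show ?thesis by simp
qed

lemma measurable_pattern_rv:
  assumes "1 \<le> l2"
  shows "pattern_rv l1 k1 l2 \<zeta> n \<in> M \<rightarrow>\<^sub>M count_space UNIV"
proof -
  have "(\<lambda>\<omega>. restrict (\<lambda>i. \<zeta> i \<omega>) {1..n}) \<in> M \<rightarrow>\<^sub>M PiM {1..n} (\<lambda>_. borel)"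
    by (intro measurable_restrict borel_measurable_trial) auto
  from measurable_compose[OF this measurable_pattern_count[OF assms]]
  have "(\<lambda>\<omega>. pattern_count l1 k1 l2 n (restrict (\<lambda>i. \<zeta> i \<omega>) {1..n})) \<in> M \<rightarrow>\<^sub>M count_space UNIV" .
  also have "(\<lambda>\<omega>. pattern_count l1 k1 l2 n (restrict (\<lambda>i. \<zeta> i \<omega>) {1..n})) = pattern_rv l1 k1 l2 \<zeta> n"
    unfolding pattern_rv_def by (intro ext pattern_count_cong assms) auto
  finally show ?thesis .
qed

lemma integrable_pattern_rv:
  fixes f :: "nat \<Rightarrow> real"
  assumes "1 \<le> l2"
  shows "integrable M (\<lambda>\<omega>. f (pattern_rv l1 k1 l2 \<zeta> n \<omega>))"
proof (rule integrable_const_bound[where B = "\<Sum>i\<le>(n + 2) * (n + 2). \<bar>f i\<bar>"])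
  show "AE \<omega> in M. norm (f (pattern_rv l1 k1 l2 \<zeta> n \<omega>)) \<le> (\<Sum>i\<le>(n + 2) * (n + 2). \<bar>f i\<bar>)"
  proof (rule AE_I2)
    fix \<omega>
    have "pattern_rv l1 k1 l2 \<zeta> n \<omega> \<in> {..(n + 2) * (n + 2)}"
      unfolding pattern_rv_def atMost_iff by (rule pattern_count_le)
    from member_le_sum[OF this, of "\<lambda>i. \<bar>f i\<bar>"]
    show "norm (f (pattern_rv l1 k1 l2 \<zeta> n \<omega>)) \<le> (\<Sum>i\<le>(n + 2) * (n + 2). \<bar>f i\<bar>)"
      by simp
  qed
  show "(\<lambda>\<omega>. f (pattern_rv l1 k1 l2 \<zeta> n \<omega>)) \<in> borel_measurable M"
    by (rule measurable_compose[OF measurable_pattern_rv[OF assms]]) simp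
qed

text \<open>The count at time \<open>k\<close> is a function of the trials in \<open>{1..k}\<close>
  and the run a function of the trials after \<open>k\<close>. These index sets are disjoint, so the
  two factors are independent.\<close>

lemma
  fixes f :: "nat \<Rightarrow> real" and l1 k1 l2 :: nat
  assumes "1 \<le> l2"
  defines "X \<equiv> \<lambda>k j \<omega>. f (pattern_rv l1 k1 l2 \<zeta> k \<omega>) * of_bool (zeros_ones (\<lambda>i. \<zeta> i \<omega>) (Suc k) j l2)"
  shows integrable_mult_zeros_ones: "integrable M (X k j)"
    and expectation_mult_zeros_ones:
      "expectation (X k j) = expectation (\<lambda>\<omega>. f (pattern_rv l1 k1 l2 \<zeta> k \<omega>)) * ((1 - p) ^ j * p ^ l2)"
proof -
  let ?A = "{1..k}" and ?B = "{Suc k..<Suc k + j + l2}"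
  define F where "F x = f (pattern_count l1 k1 l2 k x)" for x
  define G where "G x = (of_bool (zeros_ones x (Suc k) j l2) :: real)" for x
  have F: "F \<in> borel_measurable (PiM ?A (\<lambda>_. borel))"
    unfolding F_def by (rule measurable_compose[OF measurable_pattern_count[OF assms(1)]]) simp
  have eq: "Measurable.pred (PiM ?B (\<lambda>_. borel)) (\<lambda>x. x i = (c :: real))" if "i \<in> ?B" for i c
  proof -
    have "(\<lambda>x. x i) \<in> borel_measurable (PiM ?B (\<lambda>_. borel :: real measure))"
      using that by (intro measurable_component_singleton) auto
    then show ?thesis by measurable
  qed
  have "Measurable.pred (PiM ?B (\<lambda>_. borel)) (\<lambda>x. zeros_ones x (Suc k) j l2)"
    unfolding zeros_ones_def by (intro pred_intros_logic(3) pred_intros_finite eq) auto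
  then have G: "G \<in> borel_measurable (PiM ?B (\<lambda>_. borel))"
    unfolding G_def by measurable
  have restrict: "F \<circ> (\<lambda>\<omega>. restrict (\<lambda>i. \<zeta> i \<omega>) ?A) = (\<lambda>\<omega>. f (pattern_rv l1 k1 l2 \<zeta> k \<omega>))"
    "G \<circ> (\<lambda>\<omega>. restrict (\<lambda>i. \<zeta> i \<omega>) ?B) = (\<lambda>\<omega>. of_bool (zeros_ones (\<lambda>i. \<zeta> i \<omega>) (Suc k) j l2))"
    unfolding F_def G_def pattern_rv_def comp_def
    by (intro ext arg_cong[where f = f] pattern_count_cong assms; simp)
       (auto simp: zeros_ones_def)
  have ind: "indep_var borel (\<lambda>\<omega>. f (pattern_rv l1 k1 l2 \<zeta> k \<omega>))
      borel (\<lambda>\<omega>. of_bool (zeros_ones (\<lambda>i. \<zeta> i \<omega>) (Suc k) j l2) :: real)"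
    unfolding restrict[symmetric]
    by (intro indep_var_compose[OF indep_var_restrict[OF indep] F G]) auto
  note int_f = integrable_pattern_rv[OF assms(1), of f l1 k1 k]
  from indep_var_rv2[OF ind]
  have "(\<lambda>\<omega>. of_bool (zeros_ones (\<lambda>i. \<zeta> i \<omega>) (Suc k) j l2) :: real) \<in> borel_measurable M" .
  then have int: "integrable M (\<lambda>\<omega>. of_bool (zeros_ones (\<lambda>i. \<zeta> i \<omega>) (Suc k) j l2) :: real)"
    by (intro integrable_const_bound[where B = 1]) auto
  show "integrable M (X k j)"
    unfolding X_def by (rule indep_var_integrable[OF ind int_f int])
  show "expectation (X k j) =
      expectation (\<lambda>\<omega>. f (pattern_rv l1 k1 l2 \<zeta> k \<omega>)) * ((1 - p) ^ j * p ^ l2)"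
    unfolding X_def
    using indep_var_lebesgue_integral[OF ind int_f int] prob_zeros_ones[OF assms(1)]
    by (simp add: expectation_of_bool)
qed

text \<open>The increment of \<open>f\<close> is \<open>g\<close> at the previous count times the
  indicator of a new occurrence, which is a difference of indicators of two runs. For each run the
  previous count is replaced by the count before that run, and the expectation factors.\<close>

lemma expectation_pattern_rv_step:
  fixes f :: "nat \<Rightarrow> real"
  assumes "1 \<le> l1" "l1 \<le> k1" "1 \<le> l2"
  defines "m1 \<equiv> k1 - l1 + 1"
    and "E \<equiv> \<lambda>f n. expectation (\<lambda>\<omega>. f (pattern_rv l1 k1 l2 \<zeta> n \<omega>))"
    and "g \<equiv> \<lambda>h. f (Suc h) - f h"
  shows "E f (k + l1 + l2) = E f (k + l1 + l2 - 1) + (1 - p) ^ l1 * p ^ l2 *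
    (E g k - (1 - p) ^ m1 * (if m1 \<le> k then E g (k - m1) else 0))"
proof -
  let ?H = "pattern_rv l1 k1 l2 \<zeta>" and ?Z = "\<lambda>\<omega>. zeros_ones (\<lambda>i. \<zeta> i \<omega>)"
  define X where "X k j \<omega> = g (?H k \<omega>) * of_bool (?Z \<omega> (Suc k) j l2)" for k j \<omega>
  have X: "integrable M (X k j)" "expectation (X k j) = E g k * ((1 - p) ^ j * p ^ l2)" for k j
    unfolding X_def E_def
    by (rule integrable_mult_zeros_ones[OF assms(3)], rule expectation_mult_zeros_ones[OF assms(3)])
  have X_eq: "X k j \<omega> = g (?H (k + j + l2 - 1) \<omega>) * of_bool (?Z \<omega> (Suc k) j l2)" if "1 \<le> j" for k j \<omega>
  proof (cases "?Z \<omega> (Suc k) j l2")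
    case True
    then show ?thesis
      by (simp only: X_def pattern_rv_def pattern_count_zeros_ones[OF True that assms(3)])
  qed (simp add: X_def)
  \<comment> \<open>The runs that begin after \<open>k\<close> with \<open>l1\<close> zeros and
    after \<open>k - m1\<close> with \<open>k1 + 1\<close> zeros end at the same time, so
    \<open>X_eq\<close> refers both to the same previous count.\<close>
  have start: "k - m1 + (k1 + 1) + l2 - 1 = k + l1 + l2 - 1" if "m1 \<le> k"
    using that assms(2) by (simp add: m1_def)
  have m1: "m1 = k1 + 1 - l1" using assms(2) by (simp add: m1_def)
  have AE: "AE \<omega> in M. f (?H (k + l1 + l2) \<omega>) =
      f (?H (k + l1 + l2 - 1) \<omega>) + (X k l1 \<omega> - (if m1 \<le> k then X (k - m1) (k1 + 1) \<omega> else 0))"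
    using AE_binary
  proof eventually_elim
    case (elim \<omega>)
    let ?x = "\<lambda>i. \<zeta> i \<omega>" and ?n = "k + l1 + l2 - 1"
    define Y where "Y \<longleftrightarrow> (\<exists>s j. occurs_at l1 k1 l2 ?x (s, j) \<and> s + j + l2 = k + l1 + l2 + 1)"
    define B where "B \<longleftrightarrow> m1 \<le> k \<and> ?Z \<omega> (Suc (k - m1)) (k1 + 1) l2"
    have Y: "Y \<longleftrightarrow> ?Z \<omega> (Suc k) l1 l2 \<and> \<not> B"
      unfolding Y_def B_def m1 by (rule occurs_at_iff_zeros_ones) (use elim assms in auto)
    \<comment> \<open>The longer run contains the shorter one, so the indicator of \<open>Y\<close>
      is the difference of the two indicators.\<close>
    have B: "?Z \<omega> (Suc k) l1 l2" if B
    proof -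
      have "m1 \<le> k" using that by (simp add: B_def)
      then have "Suc (k - m1) + (k1 + 1) = Suc k + l1" using m1 assms(2) by arith
      moreover have "Suc (k - m1) \<le> Suc k" by simp
      ultimately show ?thesis
        using that unfolding B_def zeros_ones_def by auto
    qed
    have "Suc ?n = k + l1 + l2" "?n + 2 = k + l1 + l2 + 1" using assms by auto
    then have "?H (k + l1 + l2) \<omega> = ?H ?n \<omega> + of_bool Y"
      using pattern_count_Suc[OF assms(3), of l1 k1 ?n ?x] by (simp only: pattern_rv_def Y_def)
    then have "f (?H (k + l1 + l2) \<omega>) = f (?H ?n \<omega>) + g (?H ?n \<omega>) * of_bool Y"
      by (simp add: g_def)
    also have "g (?H ?n \<omega>) * of_bool Y = g (?H ?n \<omega>) * of_bool (?Z \<omega> (Suc k) l1 l2) - g (?H ?n \<omega>) * of_bool B"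
      using Y B by auto
    also have "g (?H ?n \<omega>) * of_bool (?Z \<omega> (Suc k) l1 l2) = X k l1 \<omega>"
      using assms(1) by (simp only: X_eq)
    also have "g (?H ?n \<omega>) * of_bool B = (if m1 \<le> k then X (k - m1) (k1 + 1) \<omega> else 0)"
      using start by (auto simp: X_eq B_def)
    finally show ?case .
  qed
  have int: "integrable M (\<lambda>\<omega>. if m1 \<le> k then X (k - m1) (k1 + 1) \<omega> else 0)"
    by (cases "m1 \<le> k") (simp_all add: X(1))
  have "E f (k + l1 + l2) = expectation (\<lambda>\<omega>. f (?H (k + l1 + l2 - 1) \<omega>) +
      (X k l1 \<omega> - (if m1 \<le> k then X (k - m1) (k1 + 1) \<omega> else 0)))"
    unfolding E_def
    using AE by (intro integral_cong_AE borel_measurable_integrable Bochner_Integration.integrable_add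
        Bochner_Integration.integrable_diff X(1) int integrable_pattern_rv assms)
  also have "\<dots> = E f (k + l1 + l2 - 1) +
      (expectation (X k l1) - expectation (\<lambda>\<omega>. if m1 \<le> k then X (k - m1) (k1 + 1) \<omega> else 0))"
    unfolding E_def using int X(1) integrable_pattern_rv[OF assms(3)]
    by (simp add: Bochner_Integration.integral_add Bochner_Integration.integral_diff)
  \<comment> \<open>The exponent splits as \<open>k1 + 1 = l1 + m1\<close>, which extracts the
    common factor.\<close>
  also have "expectation (\<lambda>\<omega>. if m1 \<le> k then X (k - m1) (k1 + 1) \<omega> else 0) =
      (1 - p) ^ l1 * p ^ l2 * ((1 - p) ^ m1 * (if m1 \<le> k then E g (k - m1) else 0))"
    using assms(2) by (simp add: X(2) m1 flip: power_add)
  also have "expectation (X k l1) = (1 - p) ^ l1 * p ^ l2 * E g k"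
    by (simp add: X(2))
  finally show ?thesis by (simp add: algebra_simps)
qed

end

section \<open>The recursions for generating function, mass function and moments\<close>

theorem theorem2p1:
  fixes M :: "'a measure" and \<zeta> :: "nat \<Rightarrow> 'a \<Rightarrow> real"
    and p q a :: real and l1 k1 l2 l m1 :: nat
    and H :: "nat \<Rightarrow> 'a \<Rightarrow> nat"
    and \<phi> :: "int \<Rightarrow> real \<Rightarrow> real" and P :: "int \<Rightarrow> int \<Rightarrow> real" and \<mu> :: "int \<Rightarrow> nat \<Rightarrow> real"
  assumes "1 \<le> l1" and "l1 \<le> k1" and "1 \<le> l2"
    and "0 \<le> p" and "p \<le> 1"
    and "bernoulli_trials M p \<zeta>"
  defines "q \<equiv> 1 - p"
    and "a \<equiv> q ^ l1 * p ^ l2"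
    and "l \<equiv> l1 + l2"
    and "m1 \<equiv> k1 - l1 + 1"
    and "H \<equiv> pattern_rv l1 k1 l2 \<zeta>"
    and "\<phi> \<equiv> gen_fun M H"
    and "P \<equiv> mass_fun M H"
    and "\<mu> \<equiv> nc_moment M H"
  shows
    "((\<forall>n t. int l \<le> n \<longrightarrow>
         \<phi> n t = \<phi> (n - 1) t
           + a * (t - 1) * (\<phi> (n - int l) t - q ^ m1 * \<phi> (n - int l - int m1) t)) \<and>
      (\<forall>n t. 0 \<le> n \<and> n \<le> int l - 1 \<longrightarrow> \<phi> n t = 1) \<and>
      (\<forall>n t. n < 0 \<longrightarrow> \<phi> n t = 0))
     \<and>
     ((\<forall>n m. int l \<le> n \<and> 0 \<le> m \<longrightarrow>
         P m n = P m (n - 1)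
           + a * (P (m - 1) (n - int l) - P m (n - int l)
                  - q ^ m1 * (P (m - 1) (n - int l - int m1) - P m (n - int l - int m1)))) \<and>
      (\<forall>n. 0 \<le> n \<and> n \<le> int l - 1 \<longrightarrow> P 0 n = 1 \<and> (\<forall>m>0. P m n = 0)) \<and>
      (\<forall>n m. n < 0 \<or> m < 0 \<longrightarrow> P m n = 0))
     \<and>
     ((\<forall>n j. int l \<le> n \<and> 1 \<le> j \<longrightarrow>
         \<mu> n j = \<mu> (n - 1) j
           + a * (\<Sum>k = 0..j - 1. real (j choose k)
                    * (\<mu> (n - int l) k - q ^ m1 * \<mu> (n - int l - int m1) k))) \<and>
      (\<forall>n\<ge>0. \<mu> n 0 = 1) \<and>
      (\<forall>n j. 0 \<le> n \<and> n \<le> int l - 1 \<and> 1 \<le> j \<longrightarrow> \<mu> n j = 0) \<and>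
      (\<forall>n j. n < 0 \<longrightarrow> \<mu> n j = 0))"
proof -
  interpret bernoulli_process M p \<zeta>
    using assms(6) by (simp add: bernoulli_trials_iff)
  \<comment> \<open>The value 0 at negative times matches the convention of all three quantities and
    absorbs the case distinction \<open>m1 \<le> k\<close>.\<close>
  define E where "E f n = (if n < 0 then 0 else expectation (\<lambda>\<omega>. f (H (nat n) \<omega>)))"
    for f :: "nat \<Rightarrow> real" and n :: int
  have integrable_H: "integrable M (\<lambda>\<omega>. f (H n \<omega>))" for f :: "nat \<Rightarrow> real" and n
    unfolding H_def by (rule integrable_pattern_rv[OF assms(3)])
  have E_mult: "E (\<lambda>h. c * f h) n = c * E f n" for c f n
    by (simp add: E_def)
  have E_diff: "E (\<lambda>h. f h - g h) n = E f n - E g n" for f g n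
    by (simp add: E_def integrable_H Bochner_Integration.integral_diff)
  have E_sum: "E (\<lambda>h. \<Sum>k\<in>K. f k h) n = (\<Sum>k\<in>K. E (f k) n)" for f n and K :: "nat set"
    by (simp add: E_def integrable_H Bochner_Integration.integral_sum)
  have E_init: "E f n = f 0" if "0 \<le> n" "n \<le> int l - 1" for f n
  proof -
    have "H (nat n) \<omega> = 0" for \<omega>
      unfolding H_def pattern_rv_def using that assms(3) by (intro pattern_count_eq_0) (auto simp: l_def)
    with that show ?thesis by (simp add: E_def prob_space)
  qed
  \<comment> \<open>The difference of \<open>f\<close> enters through a separate \<open>g\<close>,
    so that each application can supply it in the form its recursion needs.\<close>
  have E_step: "E f n = E f (n - 1) + a * (E g (n - int l) - q ^ m1 * E g (n - int l - int m1))"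
    if "int l \<le> n" and g: "\<And>h. f (Suc h) - f h = g h" for f g n
  proof -
    obtain k where k: "n = int (k + l1 + l2)"
      using \<open>int l \<le> n\<close> nat_le_iff_add[of l "nat n"] by (auto simp: l_def intro: that[of "nat n - l"])
    have index: "nat n = k + l1 + l2" "nat (n - 1) = k + l1 + l2 - 1" "nat (n - int l) = k"
      "nat (n - int l - int m1) = k - m1" "n - int l - int m1 < 0 \<longleftrightarrow> \<not> m1 \<le> k"
      "\<not> n < 0" "\<not> n - 1 < 0" "\<not> n - int l < 0"
      using assms(1) by (auto simp: k l_def)
    have "expectation (\<lambda>\<omega>. f (H (k + l1 + l2) \<omega>)) = expectation (\<lambda>\<omega>. f (H (k + l1 + l2 - 1) \<omega>)) +
        a * (expectation (\<lambda>\<omega>. g (H k \<omega>)) -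
             q ^ m1 * (if m1 \<le> k then expectation (\<lambda>\<omega>. g (H (k - m1) \<omega>)) else 0))"
      using expectation_pattern_rv_step[OF assms(1-3), of f k]
      unfolding g H_def a_def q_def m1_def .
    then show ?thesis
      by (cases "m1 \<le> k") (simp_all only: E_def index if_False if_True not_True_eq_False not_False_eq_True)
  qed
  have \<phi>: "\<phi> n t = E (\<lambda>h. t ^ h) n" for n t
    by (simp add: \<phi>_def gen_fun_def E_def)
  have P: "P m n = E (\<lambda>h. of_bool (int h = m)) n" for m n
    by (simp add: P_def mass_fun_def E_def expectation_of_bool)
  have \<mu>: "\<mu> n j = E (\<lambda>h. real h ^ j) n" for n j
    by (simp add: \<mu>_def nc_moment_def E_def)
  have \<phi>_step: "\<phi> n t = \<phi> (n - 1) t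
      + a * (t - 1) * (\<phi> (n - int l) t - q ^ m1 * \<phi> (n - int l - int m1) t)" if "int l \<le> n" for n t
  proof -
    \<comment> \<open>Here the difference of \<open>t ^ h\<close> is
      \<open>(t - 1) * t ^ h\<close>.\<close>
    have "\<phi> n t = \<phi> (n - 1) t
        + a * ((t - 1) * \<phi> (n - int l) t - q ^ m1 * ((t - 1) * \<phi> (n - int l - int m1) t))"
      unfolding \<phi> E_mult[of "t - 1", symmetric] by (rule E_step[OF that]) (simp add: left_diff_distrib)
    then show ?thesis by (simp add: algebra_simps)
  qed
  have P_step: "P m n = P m (n - 1)
      + a * (P (m - 1) (n - int l) - P m (n - int l)
             - q ^ m1 * (P (m - 1) (n - int l - int m1) - P m (n - int l - int m1)))"
    if "int l \<le> n" for m n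
    \<comment> \<open>Since \<open>int (Suc h) = m\<close> iff \<open>int h = m - 1\<close>, the
      difference of the indicator of \<open>m\<close> is the indicator of \<open>m - 1\<close> minus
      that of \<open>m\<close>.\<close>
    unfolding P E_diff[symmetric]
    by (rule E_step[OF that]) (simp add: eq_diff_eq add.commute)
  have \<mu>_step: "\<mu> n j = \<mu> (n - 1) j
      + a * (\<Sum>k = 0..j - 1. real (j choose k)
               * (\<mu> (n - int l) k - q ^ m1 * \<mu> (n - int l - int m1) k))"
    if "int l \<le> n" "1 \<le> j" for n j
  proof -
    \<comment> \<open>Splitting off the top index lets the term \<open>real h ^ j\<close> of the
      binomial expansion cancel.\<close>
    have "{..j} = insert j {0..j - 1}" using that(2) by auto
    then have "real (Suc h) ^ j - real h ^ j = (\<Sum>k = 0..j - 1. real (j choose k) * real h ^ k)" for h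
      using that(2) binomial_ring[of "real h" 1 j] by (simp add: add.commute)
    note step = E_step[OF that(1), of "\<lambda>h. real h ^ j", OF this]
    have "E (\<lambda>h. \<Sum>k = 0..j - 1. real (j choose k) * real h ^ k) n = (\<Sum>k = 0..j - 1. real (j choose k) * \<mu> n k)"
      for n
      unfolding E_sum E_mult \<mu> ..
    with step show ?thesis
      by (simp only: \<mu>[symmetric] sum_distrib_left right_diff_distrib sum_subtractf mult.left_commute)
  qed
  have "\<phi> n t = 0" "\<mu> n j = 0" if "n < 0" for n t j
    using that by (simp_all add: \<phi> \<mu> E_def)
  moreover have "\<phi> n t = 1" "1 \<le> j \<Longrightarrow> \<mu> n j = 0" "P 0 n = 1" "m > 0 \<Longrightarrow> P m n = 0"
    if "0 \<le> n" "n \<le> int l - 1" for n t j m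
    using that by (simp_all add: \<phi> \<mu> P E_init)
  moreover have "P m n = 0" if "n < 0 \<or> m < 0" for m n
    using that by (auto simp: P E_def)
  moreover have "\<mu> n 0 = 1" if "0 \<le> n" for n
    using that by (simp add: \<mu> E_def prob_space)
  ultimately show ?thesis
    using \<phi>_step P_step \<mu>_step by (intro conjI allI impI) blast+
qed

end
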